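(* For every $n\in\mathbb N$, the best constant $c_n(\alpha)$ in the Markov inequality $\|p'\|_{w_\alpha}\le c_n(\alpha)\|p\|_{w_\alpha}$, $p\in\mathcal P_n$, satisfies $$\frac{6n}{7}\le\lim_{\alpha\to\infty}\alpha\,c_n^2(\alpha)\le 3n.$$
   Context: $\mathcal P_n$ denotes the set of algebraic polynomials of degree at most $n$ with real coefficients. For $\alpha>-1$, $w_\alpha(x):=x^{\alpha}e^{-x}$ is the Laguerre weight on $(0,\infty)$ and $\|f\|_{w_\alpha}:=\big(\int_0^\infty |f(x)|^2w_\alpha(x)\,dx\big)^{1/2}$. The best Markov constant is $c_n(\alpha):=\sup_{p\in\mathcal P_n,\ p\ne0}\dfrac{\|p'\|_{w_\alpha}}{\|p\|_{w_\alpha}}$. In the limit, $n$ is fixed and $\alpha\to\infty$ through real values. *)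

theory Defs
  imports "HOL-Analysis.Analysis" "HOL-Computational_Algebra.Polynomial"
begin

definition laguerre_weight :: "real \<Rightarrow> real \<Rightarrow> real" where
  "laguerre_weight \<alpha> x = x powr \<alpha> * exp (- x)"

definition laguerre_norm :: "real \<Rightarrow> (real \<Rightarrow> real) \<Rightarrow> real" where
  "laguerre_norm \<alpha> f = sqrt (LINT x:{0<..}|lborel. \<bar>f x\<bar>\<^sup>2 * laguerre_weight \<alpha> x)"

text \<open>
  Only meaningful for \<open>\<alpha> > -1\<close>. There the integrals converge and, the polynomials of degree at
  most \<open>n\<close> forming a finite-dimensional space, the set of quotients is bounded, so that the
  supremum may be taken in the reals.
\<close>

definition markov_constant :: "nat \<Rightarrow> real \<Rightarrow> real" where
  "markov_constant n \<alpha> =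
     (SUP p \<in> {p :: real poly. degree p \<le> n \<and> p \<noteq> 0}.
        laguerre_norm \<alpha> (poly (pderiv p)) / laguerre_norm \<alpha> (poly p))"

end

theory Submission
  imports Defs "HOL-Real_Asymp.Real_Asymp"
begin

text \<open>
  The limit is in fact $n$. Write $I(p) = \int_0^\infty p\,w_\alpha$. The operator
  $T p = x p'' + (\alpha + 1 - x) p'$ satisfies $I(x p' q') = -I(T p \cdot q)$ and has the eigenvalues
  $0, -1, \dots, -n$ on polynomials of degree at most $n$, so $I(x p'^2) \le n I(p^2)$ there, with
  equality for the Laguerre polynomial of degree $n$. Integration by parts gives
  $(\alpha + 1) I(p'^2) = I(x p'^2) - 2 I(x p' p'')$, and with $s = 1/\sqrt\alpha$ the bound
  $2 |p' p''| \le s p'^2 + p''^2 / s$ makes the last term negligible as $\alpha \to \infty$.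
\<close>

section \<open>Moments and positivity of the Laguerre weight\<close>

text \<open>Taking a polynomial rather than a function as argument ensures integrability once
  \<open>\<alpha> > -1\<close>, so linearity and monotonicity hold with no side condition on the
  integrand.\<close>

definition laguerre_functional :: "real \<Rightarrow> real poly \<Rightarrow> real" where
  "laguerre_functional \<alpha> p = (LINT x:{0<..}|lborel. poly p x * laguerre_weight \<alpha> x)"

lemma laguerre_weight_nonneg: "laguerre_weight \<alpha> x \<ge> 0"
  by (simp add: laguerre_weight_def)

lemma laguerre_weight_pos: "x > 0 \<Longrightarrow> laguerre_weight \<alpha> x > 0"
  by (simp add: laguerre_weight_def)

text \<open>This is Euler's integral for \<open>Gamma\<close>. Going through the nonnegative
  integral yields integrability and the value together.\<close>

lemma has_bochner_integral_monom_laguerre_weight: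
  assumes "\<alpha> > -1"
  shows "has_bochner_integral lborel
    (\<lambda>x. indicator {0<..} x *\<^sub>R (poly (monom 1 k) x * laguerre_weight \<alpha> x)) (Gamma (\<alpha> + real k + 1))"
proof (rule has_bochner_integral_nn_integral)
  have "(\<integral>\<^sup>+ x. ennreal (indicator {0<..} x *\<^sub>R (poly (monom 1 k) x * laguerre_weight \<alpha> x)) \<partial>lborel)
      = (\<integral>\<^sup>+ x. ennreal (indicator {0..} x * x powr (\<alpha> + real k + 1 - 1) / exp x) \<partial>lborel)"
  proof (rule nn_integral_cong_AE)
    show "AE x in lborel. ennreal (indicator {0<..} x *\<^sub>R (poly (monom 1 k) x * laguerre_weight \<alpha> x))
        = ennreal (indicator {0..} x * x powr (\<alpha> + real k + 1 - 1) / exp x)"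
      \<comment> \<open>The half-lines \<open>{0<..}\<close> and \<open>{0..}\<close> differ only in
        the null set of the point 0.\<close>
      using AE_lborel_singleton[of "0::real"]
      by eventually_elim
        (auto simp: indicator_def poly_monom laguerre_weight_def powr_add powr_realpow
          exp_minus field_simps intro!: arg_cong[of _ _ ennreal])
  qed
  also have "\<dots> = ennreal (Gamma (\<alpha> + real k + 1))"
    using assms by (subst Gamma_conv_nn_integral_real) auto
  finally show "(\<integral>\<^sup>+ x. ennreal (indicator {0<..} x *\<^sub>R (poly (monom 1 k) x * laguerre_weight \<alpha> x)) \<partial>lborel)
      = ennreal (Gamma (\<alpha> + real k + 1))" .
  show "0 \<le> Gamma (\<alpha> + real k + 1)"
    using assms by (intro less_imp_le Gamma_real_pos) auto
qed (auto simp: laguerre_weight_def poly_monom indicator_def)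

lemma poly_laguerre_weight_integrable:
  assumes "\<alpha> > -1"
  shows "set_integrable lborel {0<..} (\<lambda>x. poly p x * laguerre_weight \<alpha> x)"
proof -
  have "integrable lborel (\<lambda>x. \<Sum>k\<le>degree p. coeff p k *
      (indicator {0<..} x *\<^sub>R (poly (monom 1 k) x * laguerre_weight \<alpha> x)))"
    by (intro Bochner_Integration.integrable_sum integrable_mult_right
        integrable.intros[OF has_bochner_integral_monom_laguerre_weight] assms)
  also have "(\<lambda>x. \<Sum>k\<le>degree p. coeff p k *
      (indicator {0<..} x *\<^sub>R (poly (monom 1 k) x * laguerre_weight \<alpha> x)))
    = (\<lambda>x. indicator {0<..} x *\<^sub>R (poly p x * laguerre_weight \<alpha> x))"
    by (auto simp: poly_altdef[of p] poly_monom sum_distrib_left sum_distrib_right fun_eq_iff mult_ac)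
  finally show ?thesis by (simp add: set_integrable_def)
qed

lemma laguerre_functional_monom:
  assumes "\<alpha> > -1"
  shows "laguerre_functional \<alpha> (monom 1 k) = Gamma (\<alpha> + real k + 1)"
  unfolding laguerre_functional_def set_lebesgue_integral_def
  by (rule has_bochner_integral_integral_eq[OF has_bochner_integral_monom_laguerre_weight[OF assms]])

lemma laguerre_functional_add:
  assumes "\<alpha> > -1"
  shows "laguerre_functional \<alpha> (p + q) = laguerre_functional \<alpha> p + laguerre_functional \<alpha> q"
  unfolding laguerre_functional_def
  by (simp add: distrib_right set_integral_add(2) poly_laguerre_weight_integrable assms)

lemma laguerre_functional_smult:
  "laguerre_functional \<alpha> (smult c p) = c * laguerre_functional \<alpha> p"
  unfolding laguerre_functional_def by (simp add: mult.assoc)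

lemma laguerre_functional_zero [simp]: "laguerre_functional \<alpha> 0 = 0"
  unfolding laguerre_functional_def by (simp add: set_lebesgue_integral_def)

lemma laguerre_functional_diff:
  assumes "\<alpha> > -1"
  shows "laguerre_functional \<alpha> (p - q) = laguerre_functional \<alpha> p - laguerre_functional \<alpha> q"
  using laguerre_functional_add[OF assms, of p "smult (-1) q"]
  by (simp add: laguerre_functional_smult[of _ "-1", simplified])

lemma laguerre_functional_mono:
  assumes "\<alpha> > -1" "\<And>x. x > 0 \<Longrightarrow> poly p x \<le> poly q x"
  shows "laguerre_functional \<alpha> p \<le> laguerre_functional \<alpha> q"
  unfolding laguerre_functional_def
  by (rule set_integral_mono)
    (auto intro!: poly_laguerre_weight_integrable mult_right_mono laguerre_weight_nonneg assms)

text \<open>A vanishing integral would make the nonnegative integrand zero almost everywhere. Off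
  the finitely many roots of \<open>p\<close> it is positive on the half-line, so the unit interval
  would be a null set.\<close>

lemma laguerre_functional_square_pos:
  assumes "\<alpha> > -1" "p \<noteq> 0"
  shows "laguerre_functional \<alpha> (p * p) > 0"
proof -
  let ?f = "\<lambda>x. indicator {0<..} x *\<^sub>R (poly (p * p) x * laguerre_weight \<alpha> x)"
  have nonneg: "?f x \<ge> 0" for x
    by (simp add: laguerre_weight_nonneg)
  have int: "integrable lborel ?f"
    using poly_laguerre_weight_integrable[OF assms(1), of "p * p"] by (simp only: set_integrable_def)
  have "laguerre_functional \<alpha> (p * p) \<noteq> 0"
  proof
    assume "laguerre_functional \<alpha> (p * p) = 0"
    hence "AE x in lborel. ?f x = 0"
      using integral_nonneg_eq_0_iff_AE[OF int] nonneg
      unfolding laguerre_functional_def set_lebesgue_integral_def by blast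
    moreover have "AE x in lborel. x \<notin> {x. poly p x = 0}"
      using poly_roots_finite[OF assms(2)]
      by (intro AE_not_in finite_imp_null_set_lborel)
    ultimately have "AE x in lborel. x \<notin> {0<..<(1::real)}"
    proof eventually_elim
      case (elim x)
      thus ?case using laguerre_weight_pos[of x \<alpha>] by (auto simp: indicator_def)
    qed
    hence "{0<..<(1::real)} \<in> null_sets lborel"
      by (subst (asm) AE_iff_null_sets[symmetric]) auto
    thus False by (simp add: null_sets_def)
  qed
  moreover have "laguerre_functional \<alpha> (p * p) \<ge> 0"
    using laguerre_functional_mono[OF assms(1), of 0 "p * p"] by simp
  ultimately show ?thesis by simp
qed

lemma laguerre_norm_poly:
  "laguerre_norm \<alpha> (poly p) = sqrt (laguerre_functional \<alpha> (p * p))"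
  by (simp add: laguerre_norm_def laguerre_functional_def power2_eq_square)

section \<open>Integration by parts\<close>

lemma Gamma_shift:
  assumes "(\<alpha>::real) > -1"
  shows "Gamma (\<alpha> + real (Suc k) + 1) = (\<alpha> + real k + 1) * Gamma (\<alpha> + real k + 1)"
proof -
  have "\<alpha> + real k + 1 \<notin> \<int>\<^sub>\<le>\<^sub>0"
    using assms by (auto elim!: nonpos_Ints_cases)
  thus ?thesis using Gamma_plus1[of "\<alpha> + real k + 1"] by (simp add: add_ac)
qed

text \<open>The integrand is the derivative of x p(x) w(x), with w the Laguerre weight. Instead of
  discussing boundary terms, the proof reduces by linearity to monomials, where the claim is the
  functional equation of \<open>Gamma\<close>.\<close>

lemma laguerre_functional_by_parts:
  assumes "\<alpha> > -1"
  shows "laguerre_functional \<alpha> ([:\<alpha> + 1, -1:] * p + [:0, 1:] * pderiv p) = 0"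
proof -
  let ?J = "\<lambda>p. [:\<alpha> + 1, -1:] * p + [:0, 1:] * pderiv p"
  have monom: "laguerre_functional \<alpha> (?J (monom c k)) = 0" for c k
  proof -
    have "?J (monom c k) = smult (c * (\<alpha> + real k + 1)) (monom 1 k) - smult c (monom 1 (Suc k))"
      by (rule poly_eqI) (auto simp: coeff_pCons pderiv_monom algebra_simps split: nat.splits)
    thus ?thesis
      by (simp only: laguerre_functional_diff[OF assms] laguerre_functional_smult
          laguerre_functional_monom[OF assms] Gamma_shift[OF assms])
  qed
  have "laguerre_functional \<alpha> (?J (\<Sum>i\<in>S. monom (coeff p i) i)) = 0" if "finite S" for S
    using that
  proof (induction S)
    case (insert i S)
    have "?J (\<Sum>i\<in>insert i S. monom (coeff p i) i)
        = ?J (monom (coeff p i) i) + ?J (\<Sum>i\<in>S. monom (coeff p i) i)"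
      using insert.hyps by (simp add: pderiv_add distrib_left add_ac smult_add_right del: mult_pCons_left)
    hence "laguerre_functional \<alpha> (?J (\<Sum>i\<in>insert i S. monom (coeff p i) i))
        = laguerre_functional \<alpha> (?J (monom (coeff p i) i))
          + laguerre_functional \<alpha> (?J (\<Sum>i\<in>S. monom (coeff p i) i))"
      by (simp only: laguerre_functional_add[OF assms])
    thus ?case by (simp only: insert.IH monom add_0_left)
  qed (simp del: mult_pCons_left)
  from this[of "{..degree p}"] show ?thesis by (simp only: poly_as_sum_of_monoms finite_atMost)
qed

section \<open>The Laguerre operator and the sharp Markov inequality with the extra factor x\<close>

definition laguerre_operator :: "real \<Rightarrow> real poly \<Rightarrow> real poly" where
  "laguerre_operator \<alpha> p = [:0, 1:] * pderiv (pderiv p) + [:\<alpha> + 1, -1:] * pderiv p"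

text \<open>Integration by parts for \<open>pderiv p * q\<close>. With an eigenfunction as
  \<open>p\<close>, it turns the derivative form into a multiple of the inner product.\<close>

lemma laguerre_dirichlet_form:
  assumes "\<alpha> > -1"
  shows "laguerre_functional \<alpha> ([:0, 1:] * (pderiv p * pderiv q))
    = - laguerre_functional \<alpha> (laguerre_operator \<alpha> p * q)"
proof -
  have "[:\<alpha> + 1, -1:] * (pderiv p * q) + [:0, 1:] * pderiv (pderiv p * q)
      = laguerre_operator \<alpha> p * q + [:0, 1:] * (pderiv p * pderiv q)"
    by (rule poly_eq_poly_eq_iff[THEN iffD1], rule ext) (simp add: pderiv_mult laguerre_operator_def algebra_simps)
  with laguerre_functional_by_parts[OF assms, of "pderiv p * q"]
  have "laguerre_functional \<alpha> (laguerre_operator \<alpha> p * q + [:0, 1:] * (pderiv p * pderiv q)) = 0"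
    by simp
  thus ?thesis by (simp only: laguerre_functional_add[OF assms])
qed

text \<open>The eigenfunction is the Laguerre polynomial up to a scalar factor.\<close>

lemma laguerre_eigenpoly:
  assumes "\<alpha> > -1"
  obtains L where "degree L \<le> n" "coeff L n \<noteq> 0" "laguerre_operator \<alpha> L = smult (- real n) L"
proof -
  define l where "l k = (if k \<le> n then (-1) ^ k / (fact k * fact (n - k) * Gamma (\<alpha> + real k + 1)) else 0)"
    for k
  define L where "L = (\<Sum>k\<le>n. monom (l k) k)"
  have coeff_L: "coeff L k = l k" for k
    by (simp add: L_def coeff_sum l_def)
  \<comment> \<open>This is the coefficient of x^k in the eigenvalue equation. For k = n the first
    factor vanishes, and beyond the degree the default value 0 of \<open>l\<close> makes both terms
    vanish.\<close>
  have rec: "(real n - real k) * l k + (real k + 1) * (\<alpha> + real k + 1) * l (Suc k) = 0" for k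
  proof (cases "k < n")
    case True
    have G0: "Gamma (\<alpha> + real k + 1) > 0" "\<alpha> + real k + 1 > 0"
      using assms by (auto intro!: Gamma_real_pos)
    obtain m where m: "n = Suc (k + m)" using True less_imp_Suc_add by blast
    have "real n - real k = real (Suc m)" by (simp add: m)
    moreover have "real (Suc m) * l k = (-1) ^ k / (fact k * fact m * Gamma (\<alpha> + real k + 1))"
      by (simp add: l_def m Suc_diff_le del: of_nat_Suc)
    moreover have "(real k + 1) * (\<alpha> + real k + 1) * l (Suc k)
        = - ((-1) ^ k) / (fact k * fact m * Gamma (\<alpha> + real k + 1))"
      unfolding l_def Gamma_shift[OF assms] using G0 by (simp add: m divide_simps)
    ultimately show ?thesis by simp
  qed (auto simp: l_def)
  have "laguerre_operator \<alpha> L = smult (- real n) L"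
  proof (rule poly_eqI)
    fix k
    have "coeff (laguerre_operator \<alpha> L) k
        = (real k + 1) * (\<alpha> + real k + 1) * l (Suc k) - real k * l k"
      by (cases k) (auto simp: laguerre_operator_def coeff_pderiv coeff_L algebra_simps)
    also have "\<dots> = - real n * l k" using rec[of k] by (simp add: algebra_simps)
    finally show "coeff (laguerre_operator \<alpha> L) k = coeff (smult (- real n) L) k"
      by (simp add: coeff_L)
  qed
  moreover have "coeff L n \<noteq> 0"
    using assms less_imp_neq[OF Gamma_real_pos[of "\<alpha> + real n + 1"]] by (simp add: coeff_L l_def)
  moreover have "degree L \<le> n"
    by (rule degree_le) (simp add: coeff_L l_def)
  ultimately show ?thesis using that by blast
qed

text \<open>Induction on the degree bound, splitting off a multiple of the eigenfunction
  \<open>L\<close> that removes the leading term. By \<open>form\<close>, every term containing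
  \<open>L\<close> contributes to both sides equally, with factor exactly \<open>Suc n\<close>, so
  only the remainder \<open>q\<close> of lower degree is left to estimate.\<close>

lemma laguerre_weighted_markov:
  assumes "\<alpha> > -1" "degree p \<le> n"
  shows "laguerre_functional \<alpha> ([:0, 1:] * (pderiv p * pderiv p)) \<le> real n * laguerre_functional \<alpha> (p * p)"
  using assms(2)
proof (induction n arbitrary: p)
  case 0
  hence "pderiv p = 0" by (simp add: pderiv_eq_0_iff)
  thus ?case by simp
next
  case (Suc n)
  obtain L where L: "degree L \<le> Suc n" "coeff L (Suc n) \<noteq> 0"
    "laguerre_operator \<alpha> L = smult (- real (Suc n)) L"
    using laguerre_eigenpoly[OF assms(1)] by blast
  define c where "c = coeff p (Suc n) / coeff L (Suc n)"
  define q where "q = p - smult c L"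
  have p: "p = q + smult c L" by (simp add: q_def)
  have "coeff q i = 0" if "i > n" for i
  proof (cases "i = Suc n")
    case True
    thus ?thesis using L by (simp add: q_def c_def)
  next
    case False
    thus ?thesis using that Suc.prems L(1) by (simp add: q_def coeff_eq_0)
  qed
  hence "degree q \<le> n" by (auto intro: degree_le)
  note IH = Suc.IH[OF this]
  have form: "laguerre_functional \<alpha> ([:0, 1:] * (pderiv L * pderiv r))
      = real (Suc n) * laguerre_functional \<alpha> (L * r)" for r
    using laguerre_dirichlet_form[OF assms(1), of L r]
    by (simp only: L(3) mult_smult_left laguerre_functional_smult)
  have eq1: "[:0, 1:] * (pderiv p * pderiv p) = [:0, 1:] * (pderiv q * pderiv q)
      + (smult (2 * c) ([:0, 1:] * (pderiv L * pderiv q)) + smult (c * c) ([:0, 1:] * (pderiv L * pderiv L)))"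
    unfolding p by (rule poly_eq_poly_eq_iff[THEN iffD1], rule ext) (simp add: pderiv_add pderiv_smult algebra_simps)
  have eq2: "p * p = q * q + (smult (2 * c) (L * q) + smult (c * c) (L * L))"
    unfolding p by (rule poly_eq_poly_eq_iff[THEN iffD1], rule ext) (simp add: algebra_simps)
  \<comment> \<open>Nonnegativity allows the factor \<open>n\<close> from the induction hypothesis
    for \<open>q\<close> to be raised to \<open>Suc n\<close>.\<close>
  have "laguerre_functional \<alpha> (q * q) \<ge> 0"
    using laguerre_functional_mono[OF assms(1), of 0 "q * q"] by simp
  thus ?case
    using IH unfolding eq1 eq2
    by (simp only: laguerre_functional_add[OF assms(1)] laguerre_functional_smult form)
      (auto simp: algebra_simps)
qed

section \<open>Removing the factor x from the derivative norm\<close>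

lemma laguerre_pderiv_identity:
  assumes "\<alpha> > -1"
  shows "(\<alpha> + 1) * laguerre_functional \<alpha> (pderiv p * pderiv p)
    = laguerre_functional \<alpha> ([:0, 1:] * (pderiv p * pderiv p))
      - 2 * laguerre_functional \<alpha> ([:0, 1:] * (pderiv p * pderiv (pderiv p)))"
proof -
  have "[:\<alpha> + 1, -1:] * (pderiv p * pderiv p) + [:0, 1:] * pderiv (pderiv p * pderiv p)
    = smult (\<alpha> + 1) (pderiv p * pderiv p) - [:0, 1:] * (pderiv p * pderiv p)
      + smult 2 ([:0, 1:] * (pderiv p * pderiv (pderiv p)))"
    by (rule poly_eq_poly_eq_iff[THEN iffD1], rule ext) (simp add: pderiv_mult algebra_simps)
  with laguerre_functional_by_parts[OF assms, of "pderiv p * pderiv p"] show ?thesis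
    by (simp only: laguerre_functional_add[OF assms] laguerre_functional_diff[OF assms]
        laguerre_functional_smult)
qed

text \<open>The difference is the mixed term of \<open>laguerre_pderiv_identity\<close>. Weighted
  AM-GM splits it into the forms of p' and p'', which are bounded by applying
  \<open>laguerre_weighted_markov\<close> to \<open>p\<close> and to \<open>pderiv p\<close>. The
  absolute value serves both the upper and the lower estimate of the constant.\<close>

lemma laguerre_pderiv_perturbation:
  assumes "\<alpha> > -1" "degree p \<le> n" "s > 0"
  shows "\<bar>(\<alpha> + 1) * laguerre_functional \<alpha> (pderiv p * pderiv p)
      - laguerre_functional \<alpha> ([:0, 1:] * (pderiv p * pderiv p))\<bar>
    \<le> s * real n * laguerre_functional \<alpha> (p * p)
      + real n / s * laguerre_functional \<alpha> (pderiv p * pderiv p)"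
proof -
  let ?I = "laguerre_functional \<alpha>" and ?X = "[:0, 1:] :: real poly"
  let ?p1 = "pderiv p" and ?p2 = "pderiv (pderiv p)"
  \<comment> \<open>The sign \<open>e\<close> satisfies e^2 = 1. Using both signs later gives the
    bound on the absolute value.\<close>
  have amgm: "2 * (e * (a * b)) \<le> s * (a * a) + inverse s * (b * b)" if "e \<in> {-1, 1}" for a b e :: real
  proof -
    have "0 \<le> (s * a - e * b)\<^sup>2 / s" using assms(3) by simp
    also have "\<dots> = s * (a * a) + inverse s * (b * b) - 2 * (e * (a * b))"
      using assms(3) that by (auto simp: field_simps power2_eq_square)
    finally show ?thesis by simp
  qed
  have "2 * e * ?I (?X * (?p1 * ?p2)) \<le> s * ?I (?X * (?p1 * ?p1)) + inverse s * ?I (?X * (?p2 * ?p2))"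
    if "e \<in> {-1, 1}" for e
  proof -
    have "?I (smult (2 * e) (?X * (?p1 * ?p2)))
        \<le> ?I (smult s (?X * (?p1 * ?p1)) + smult (inverse s) (?X * (?p2 * ?p2)))"
    proof (rule laguerre_functional_mono[OF assms(1)])
      fix x :: real assume "x > 0"
      from mult_left_mono[OF amgm[OF that, of "poly ?p1 x" "poly ?p2 x"], of x] this
      show "poly (smult (2 * e) (?X * (?p1 * ?p2))) x
          \<le> poly (smult s (?X * (?p1 * ?p1)) + smult (inverse s) (?X * (?p2 * ?p2))) x"
        by (simp add: algebra_simps)
    qed
    thus ?thesis by (simp only: laguerre_functional_add[OF assms(1)] laguerre_functional_smult)
  qed
  from this[of 1] this[of "-1"]
  have "\<bar>2 * ?I (?X * (?p1 * ?p2))\<bar> \<le> s * ?I (?X * (?p1 * ?p1)) + inverse s * ?I (?X * (?p2 * ?p2))"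
    by simp
  also have "\<dots> \<le> s * (real n * ?I (p * p)) + inverse s * (real n * ?I (?p1 * ?p1))"
    using assms(2,3)
    by (intro add_mono mult_left_mono laguerre_weighted_markov assms(1)) (auto simp: degree_pderiv)
  finally show ?thesis
    using laguerre_pderiv_identity[OF assms(1), of p] by (simp add: divide_inverse mult_ac)
qed

section \<open>Two-sided bounds for the Markov constant and the limit\<close>

lemma markov_quotient_upper:
  assumes "\<alpha> > -1" "degree p \<le> n" "s > 0" "\<alpha> + 1 > real n / s" "p \<noteq> 0"
  shows "laguerre_norm \<alpha> (poly (pderiv p)) / laguerre_norm \<alpha> (poly p)
    \<le> sqrt (real n * (1 + s) / (\<alpha> + 1 - real n / s))"
proof -
  let ?I = "laguerre_functional \<alpha>"
  have pos: "?I (p * p) > 0" by (rule laguerre_functional_square_pos[OF assms(1,5)])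
  \<comment> \<open>The error term with \<open>real n / s\<close> is absorbed into the left side;
    the hypothesis \<open>\<alpha> + 1 > real n / s\<close> keeps the resulting factor positive for
    the division.\<close>
  have "(\<alpha> + 1 - real n / s) * ?I (pderiv p * pderiv p) \<le> real n * (1 + s) * ?I (p * p)"
    using laguerre_pderiv_perturbation[OF assms(1-3)] laguerre_weighted_markov[OF assms(1,2)]
    by (simp add: algebra_simps abs_le_iff del: mult_pCons_left)
  hence "?I (pderiv p * pderiv p) / ?I (p * p) \<le> real n * (1 + s) / (\<alpha> + 1 - real n / s)"
    using pos assms(4) by (simp only: pos_divide_le_eq pos_le_divide_eq diff_gt_0_iff_gt
        times_divide_eq_left) (simp add: mult_ac)
  thus ?thesis by (simp add: laguerre_norm_poly flip: real_sqrt_divide)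
qed

text \<open>The witness is the eigenfunction of degree \<open>n\<close>: it attains equality in
  \<open>laguerre_weighted_markov\<close>, so only the perturbation is lost.\<close>

lemma markov_quotient_lower:
  assumes "\<alpha> > -1" "s > 0"
  obtains p where "degree p \<le> n" "p \<noteq> 0"
    "laguerre_norm \<alpha> (poly (pderiv p)) / laguerre_norm \<alpha> (poly p)
      \<ge> sqrt (real n * (1 - s) / (\<alpha> + 1 + real n / s))"
proof -
  let ?I = "laguerre_functional \<alpha>"
  obtain L where L: "degree L \<le> n" "coeff L n \<noteq> 0" "laguerre_operator \<alpha> L = smult (- real n) L"
    using laguerre_eigenpoly[OF assms(1)] by blast
  have "L \<noteq> 0" using L(2) by auto
  hence pos: "?I (L * L) > 0" by (rule laguerre_functional_square_pos[OF assms(1)])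
  have "?I ([:0, 1:] * (pderiv L * pderiv L)) = real n * ?I (L * L)"
    using laguerre_dirichlet_form[OF assms(1), of L L]
    by (simp only: L(3) mult_smult_left laguerre_functional_smult)
  with laguerre_pderiv_perturbation[OF assms(1) L(1) assms(2)]
  have "real n * (1 - s) * ?I (L * L) \<le> (\<alpha> + 1 + real n / s) * ?I (pderiv L * pderiv L)"
    by (simp add: algebra_simps abs_le_iff del: mult_pCons_left)
  moreover have "\<alpha> + 1 + real n / s > 0" using assms by (intro add_pos_nonneg[of "\<alpha> + 1"] divide_nonneg_pos) auto
  ultimately have "real n * (1 - s) / (\<alpha> + 1 + real n / s) \<le> ?I (pderiv L * pderiv L) / ?I (L * L)"
    using pos by (simp only: pos_divide_le_eq pos_le_divide_eq times_divide_eq_left) (simp add: mult_ac)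
  hence "sqrt (real n * (1 - s) / (\<alpha> + 1 + real n / s))
      \<le> laguerre_norm \<alpha> (poly (pderiv L)) / laguerre_norm \<alpha> (poly L)"
    by (simp add: laguerre_norm_poly flip: real_sqrt_divide)
  with that L(1) \<open>L \<noteq> 0\<close> show ?thesis by blast
qed

lemma markov_constant_bounds:
  assumes "\<alpha> > -1" "0 < s" "s \<le> 1" "\<alpha> + 1 > real n / s"
  shows "(markov_constant n \<alpha>)\<^sup>2 \<le> real n * (1 + s) / (\<alpha> + 1 - real n / s)"
    and "real n * (1 - s) / (\<alpha> + 1 + real n / s) \<le> (markov_constant n \<alpha>)\<^sup>2"
proof -
  let ?P = "{p :: real poly. degree p \<le> n \<and> p \<noteq> 0}"
  let ?U = "real n * (1 + s) / (\<alpha> + 1 - real n / s)"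
  let ?l = "real n * (1 - s) / (\<alpha> + 1 + real n / s)"
  let ?q = "\<lambda>p. laguerre_norm \<alpha> (poly (pderiv p)) / laguerre_norm \<alpha> (poly p)"
  have le: "?q p \<le> sqrt ?U" if "p \<in> ?P" for p
    using that markov_quotient_upper[OF assms(1) _ assms(2,4)] by blast
  obtain p where "degree p \<le> n" "p \<noteq> 0" "sqrt ?l \<le> ?q p"
    by (rule markov_quotient_lower[OF assms(1,2)])
  hence p: "p \<in> ?P" "sqrt ?l \<le> ?q p" by simp_all
  \<comment> \<open>The supremum is taken in the reals: \<open>p\<close> shows that the set of
    quotients is nonempty, and \<open>le\<close> that it is bounded above.\<close>
  have "markov_constant n \<alpha> \<le> sqrt ?U"
    unfolding markov_constant_def using p(1) le by (intro cSUP_least) auto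
  moreover have "?q p \<le> markov_constant n \<alpha>"
    unfolding markov_constant_def using p(1) le by (intro cSUP_upper bdd_aboveI2)
  \<comment> \<open>Here \<open>s \<le> 1\<close> enters. It makes the lower bound nonnegative,
    hence also the constant, and squaring then preserves the upper bound.\<close>
  moreover have "?l \<ge> 0" using assms by (auto intro!: divide_nonneg_nonneg add_nonneg_nonneg)
  moreover have "?U \<ge> 0" using assms by (auto intro!: divide_nonneg_nonneg)
  ultimately have b: "sqrt ?l \<le> markov_constant n \<alpha>" "markov_constant n \<alpha> \<le> sqrt ?U"
    and nn: "?l \<ge> 0" "?U \<ge> 0"
    using p(2) by linarith+
  have "0 \<le> markov_constant n \<alpha>"
    using b(1) real_sqrt_ge_zero[OF nn(1)] by linarith
  with b nn show "(markov_constant n \<alpha>)\<^sup>2 \<le> ?U" "?l \<le> (markov_constant n \<alpha>)\<^sup>2"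
    using power_mono[of "markov_constant n \<alpha>" "sqrt ?U" 2] sqrt_le_D[of ?l] by auto
qed

lemma markov_constant_limit:
  "((\<lambda>\<alpha>. \<alpha> * (markov_constant n \<alpha>)\<^sup>2) \<longlongrightarrow> real n) at_top"
proof (rule tendsto_sandwich)
  \<comment> \<open>This choice sends both \<open>?s \<alpha>\<close> and
    \<open>real n / ?s \<alpha>\<close> divided by \<open>\<alpha>\<close> to 0, so both bounds
    times \<open>\<alpha>\<close> tend to \<open>n\<close>.\<close>
  let ?s = "\<lambda>\<alpha>::real. 1 / sqrt \<alpha>"
  have "eventually (\<lambda>\<alpha>::real. \<alpha> > 1 \<and> \<alpha> + 1 > real n * sqrt \<alpha>) at_top"
    by (intro eventually_conj) real_asymp+
  hence ev: "eventually (\<lambda>\<alpha>. \<alpha> > -1 \<and> 0 < ?s \<alpha> \<and> ?s \<alpha> \<le> 1 \<and> \<alpha> + 1 > real n / ?s \<alpha> \<and> \<alpha> > 0) at_top"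
    by eventually_elim auto
  show "eventually (\<lambda>\<alpha>. \<alpha> * (real n * (1 - ?s \<alpha>) / (\<alpha> + 1 + real n / ?s \<alpha>))
      \<le> \<alpha> * (markov_constant n \<alpha>)\<^sup>2) at_top"
    using ev by eventually_elim (intro mult_left_mono markov_constant_bounds, auto)
  show "eventually (\<lambda>\<alpha>. \<alpha> * (markov_constant n \<alpha>)\<^sup>2
      \<le> \<alpha> * (real n * (1 + ?s \<alpha>) / (\<alpha> + 1 - real n / ?s \<alpha>))) at_top"
    using ev by eventually_elim (intro mult_left_mono markov_constant_bounds, auto)
  show "((\<lambda>\<alpha>. \<alpha> * (real n * (1 - ?s \<alpha>) / (\<alpha> + 1 + real n / ?s \<alpha>))) \<longlongrightarrow> real n) at_top"
    \<comment> \<open>For \<open>n = 0\<close> the expression is identically 0; otherwise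
      \<open>n\<close> is a nonzero leading coefficient.\<close>
    by (cases "n = 0") (simp, real_asymp)
  show "((\<lambda>\<alpha>. \<alpha> * (real n * (1 + ?s \<alpha>) / (\<alpha> + 1 - real n / ?s \<alpha>))) \<longlongrightarrow> real n) at_top"
    by (cases "n = 0") (simp, real_asymp)
qed

theorem corollary1p4:
  fixes n :: nat
  shows "\<exists>L :: real. ((\<lambda>\<alpha> :: real. \<alpha> * (markov_constant n \<alpha>)\<^sup>2) \<longlongrightarrow> L) at_top
           \<and> 6 * real n / 7 \<le> L \<and> L \<le> 3 * real n"
  \<comment> \<open>The exact limit \<open>n\<close> lies in the stated range because it is
    nonnegative.\<close>
  using markov_constant_limit[of n] by (intro exI[of _ "real n"]) auto

end
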